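(* For any solution of the fully discrete MHD scheme (a)–(g) described in the context, with initial data satisfying $\nabla\cdot\bm{B}_h^0=0$, the following identity for the cross helicity holds at each time step: $$D_t\int_\Omega\bm{u}_h\cdot\bm{B}_h\,dx=-R_e^{-1}(\nabla\times\bm{u}_h,\nabla\times\bm{H}_h)-R_m^{-1}(\nabla\times\bm{u}_h,\bm{j}_h)+(\bm{f},\bm{H}_h).$$
   Context: $\Omega\subset\mathbb{R}^3$ is a contractible bounded Lipschitz domain with unit outer normal $\bm{n}$; $(\cdot,\cdot)$ and $\|\cdot\|$ are the $L^2(\Omega)$ inner product and norm. $H_0(\mathrm{grad},\Omega)$, $H_0(\mathrm{curl},\Omega)$, $H_0(\mathrm{div},\Omega)$ are the usual spaces of $L^2$ fields with $L^2$ gradient/curl/divergence and vanishing trace $v$, $v\times \bm{n}$, $v\cdot\bm{n}$ on $\partial\Omega$, respectively; $L^2_0(\Omega)$ is the space of mean-zero $L^2$ functions. $H_0^h(\mathrm{grad},\Omega)$, $H_0^h(\mathrm{curl},\Omega)$, $H_0^h(\mathrm{div},\Omega)$, $L_0^{2,h}(\Omega)$ are finite-dimensional (piecewise polynomial finite element) subspaces of these spaces forming a discrete de Rham complex $$0\to H_0^h(\mathrm{grad},\Omega)\xrightarrow{\mathrm{grad}} H_0^h(\mathrm{curl},\Omega)\xrightarrow{\mathrm{curl}} H_0^h(\mathrm{div},\Omega)\xrightarrow{\mathrm{div}} L_0^{2,h}(\Omega)\to 0,$$ which is exact. Scheme. Let $\Delta t>0$ be the time step, $\mathsf{c}>0$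 the coupling number, $R_e,R_m\in(0,\infty]$ the fluid and magnetic Reynolds numbers (with $R^{-1}=0$ when $R=\infty$), and $\bm{f}\in [L^2(\Omega)]^3$ a given source (evaluated at the midpoint of each time interval). Given $(\bm{u}_h^0,\bm{B}_h^0)\in H_0^h(\mathrm{curl},\Omega)\times H_0^h(\mathrm{div},\Omega)$, for $n=0,1,2,\dots$ one seeks $\bm{u}_h^{n+1},\bm{\omega}_h^{n+1/2},\bm{j}_h^{n+1/2},\bm{E}_h^{n+1/2},\bm{H}_h^{n+1/2}\in H_0^h(\mathrm{curl},\Omega)$, $\bm{B}_h^{n+1}\in H_0^h(\mathrm{div},\Omega)$, $P_h^{n+1/2}\in H_0^h(\mathrm{grad},\Omega)$ such that for all $\bm{v}_h,\bm{\mu}_h,\bm{k}_h,\bm{F}_h,\bm{G}_h\in H_0^h(\mathrm{curl},\Omega)$, $\bm{C}_h\in H_0^h(\mathrm{div},\Omega)$, $Q_h\in H_0^h(\mathrm{grad},\Omega)$: (a) $(D_t\bm{u}_h,\bm{v}_h)-(\bm{u}_h\times\bm{\omega}_h,\bm{v}_h)+R_e^{-1}(\nabla\times\bm{u}_h,\nabla\times\bm{v}_h)+(\nabla P_h,\bm{v}_h)-\mathsf{c}(\bm{j}_h\times\bm{H}_h,\bm{v}_h)=(\bm{f},\bm{v}_h)$; (b) $(D_t\bm{B}_h,\bm{C}_h)+(\nabla\times\bm{E}_h,\bm{C}_h)=0$; (c) $(R_m^{-1}\bm{j}_h-[\bm{E}_h+\bm{u}_h\times\bm{H}_h],\bm{G}_h)=0$;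 (d) $(\bm{\omega}_h,\bm{\mu}_h)-(\nabla\times\bm{u}_h,\bm{\mu}_h)=0$; (e) $(\bm{j}_h,\bm{k}_h)-(\bm{B}_h,\nabla\times\bm{k}_h)=0$; (f) $(\bm{B}_h,\bm{F}_h)-(\bm{H}_h,\bm{F}_h)=0$; (g) $(\bm{u}_h,\nabla Q_h)=0$. Here $D_t\bm{u}_h=(\bm{u}_h^{n+1}-\bm{u}_h^n)/\Delta t$, $D_t\bm{B}_h=(\bm{B}_h^{n+1}-\bm{B}_h^n)/\Delta t$, $\bm{u}_h=(\bm{u}_h^{n+1}+\bm{u}_h^n)/2$, $\bm{B}_h=(\bm{B}_h^{n+1}+\bm{B}_h^n)/2$, and $\bm{\omega}_h,\bm{j}_h,\bm{E}_h,\bm{H}_h,P_h$ denote the midpoint unknowns with superscript $n+1/2$. For integrals of products, $D_t\int_\Omega\bm{a}\cdot\bm{b}\,dx:=\frac{1}{\Delta t}\left(\int_\Omega\bm{a}^{n+1}\cdot\bm{b}^{n+1}\,dx-\int_\Omega\bm{a}^{n}\cdot\bm{b}^{n}\,dx\right)$. *)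

theory Defs
  imports "HOL-Analysis.Analysis"
begin

type_synonym scalar_field = "real^3 \<Rightarrow> real"
type_synonym vector_field = "real^3 \<Rightarrow> real^3"


section \<open>Domains\<close>

text \<open>Near each boundary point the domain is, after a rigid motion, the strict epigraph of a
  Lipschitz function of two variables.\<close>

definition lipschitz_boundary :: "(real^3) set \<Rightarrow> bool" where
  "lipschitz_boundary \<Omega> \<longleftrightarrow>
     (\<forall>p \<in> frontier \<Omega>. \<exists>(T :: real^3 \<Rightarrow> real^3) (\<gamma> :: real^2 \<Rightarrow> real) L r.
        orthogonal_transformation T \<and> lipschitz_on L UNIV \<gamma> \<and> r > 0 \<and>
        \<Omega> \<inter> ball p r =
          {x \<in> ball p r. let y = T (x - p) in \<gamma> (vector [y $ 1, y $ 2]) < y $ 3})"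

definition lipschitz_domain :: "(real^3) set \<Rightarrow> bool" where
  "lipschitz_domain \<Omega> \<longleftrightarrow>
     \<Omega> \<noteq> {} \<and> open \<Omega> \<and> connected \<Omega> \<and> bounded \<Omega> \<and> lipschitz_boundary \<Omega>"


section \<open>Smooth fields and their classical derivatives\<close>

definition pd :: "3 \<Rightarrow> (real^3 \<Rightarrow> 'b::real_normed_vector) \<Rightarrow> real^3 \<Rightarrow> 'b" where
  "pd i f x = frechet_derivative f (at x) (axis i 1)"

primrec Ck :: "nat \<Rightarrow> (real^3 \<Rightarrow> 'b::real_normed_vector) \<Rightarrow> bool" where
  "Ck 0 f \<longleftrightarrow> continuous_on UNIV f"
| "Ck (Suc k) f \<longleftrightarrow> (\<forall>x. f differentiable (at x)) \<and> (\<forall>i. Ck k (pd i f))"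

definition smooth :: "(real^3 \<Rightarrow> 'b::real_normed_vector) \<Rightarrow> bool" where
  "smooth f \<longleftrightarrow> (\<forall>k. Ck k f)"

definition test_field :: "(real^3) set \<Rightarrow> (real^3 \<Rightarrow> 'b::real_normed_vector) \<Rightarrow> bool" where
  "test_field \<Omega> \<phi> \<longleftrightarrow>
     smooth \<phi> \<and> compact (closure {x. \<phi> x \<noteq> 0}) \<and> closure {x. \<phi> x \<noteq> 0} \<subseteq> \<Omega>"

definition cgrad :: "scalar_field \<Rightarrow> vector_field" where
  "cgrad \<phi> x = (\<chi> i. pd i \<phi> x)"

definition ccurl :: "vector_field \<Rightarrow> vector_field" where
  "ccurl \<phi> x = vector [pd 2 \<phi> x $ 3 - pd 3 \<phi> x $ 2,
                       pd 3 \<phi> x $ 1 - pd 1 \<phi> x $ 3,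
                       pd 1 \<phi> x $ 2 - pd 2 \<phi> x $ 1]"

definition cdiv :: "vector_field \<Rightarrow> scalar_field" where
  "cdiv \<phi> x = (\<Sum>i\<in>UNIV. pd i \<phi> x $ i)"


section \<open>Square integrable fields and weak derivatives\<close>

text \<open>Elements of \<open>L\<^sup>2\<close> are represented by functions on the whole space, of which only the
  restriction to the domain matters, up to almost everywhere equality. All the spaces
  below are closed under changing the representative.\<close>

definition L2 :: "(real^3) set \<Rightarrow> (real^3 \<Rightarrow> 'b::euclidean_space) set" where
  "L2 \<Omega> = {v \<in> borel_measurable (lebesgue_on \<Omega>). integrable (lebesgue_on \<Omega>) (\<lambda>x. (norm (v x))\<^sup>2)}"

definition ip :: "(real^3) set \<Rightarrow> (real^3 \<Rightarrow> 'b::euclidean_space) \<Rightarrow> (real^3 \<Rightarrow> 'b) \<Rightarrow> real" where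
  "ip \<Omega> v w = (LINT x|lebesgue_on \<Omega>. v x \<bullet> w x)"

definition ae_eq :: "(real^3) set \<Rightarrow> (real^3 \<Rightarrow> 'b) \<Rightarrow> (real^3 \<Rightarrow> 'b) \<Rightarrow> bool" where
  "ae_eq \<Omega> v w \<longleftrightarrow> (AE x in lebesgue_on \<Omega>. v x = w x)"

definition has_weak_grad :: "(real^3) set \<Rightarrow> scalar_field \<Rightarrow> vector_field \<Rightarrow> bool" where
  "has_weak_grad \<Omega> q g \<longleftrightarrow>
     g \<in> L2 \<Omega> \<and> (\<forall>\<phi>. test_field \<Omega> \<phi> \<longrightarrow> ip \<Omega> q (cdiv \<phi>) = - ip \<Omega> g \<phi>)"

definition has_weak_curl :: "(real^3) set \<Rightarrow> vector_field \<Rightarrow> vector_field \<Rightarrow> bool" where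
  "has_weak_curl \<Omega> v w \<longleftrightarrow>
     w \<in> L2 \<Omega> \<and> (\<forall>\<phi>. test_field \<Omega> \<phi> \<longrightarrow> ip \<Omega> v (ccurl \<phi>) = ip \<Omega> w \<phi>)"

definition has_weak_div :: "(real^3) set \<Rightarrow> vector_field \<Rightarrow> scalar_field \<Rightarrow> bool" where
  "has_weak_div \<Omega> v d \<longleftrightarrow>
     d \<in> L2 \<Omega> \<and> (\<forall>\<phi>. test_field \<Omega> \<phi> \<longrightarrow> ip \<Omega> v (cgrad \<phi>) = - ip \<Omega> d \<phi>)"

text \<open>Weak derivatives are unique only up to null sets, so the operators choose a representative.\<close>

definition wgrad :: "(real^3) set \<Rightarrow> scalar_field \<Rightarrow> vector_field" where
  "wgrad \<Omega> q = (SOME g. has_weak_grad \<Omega> q g)"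

definition wcurl :: "(real^3) set \<Rightarrow> vector_field \<Rightarrow> vector_field" where
  "wcurl \<Omega> v = (SOME w. has_weak_curl \<Omega> v w)"

definition wdiv :: "(real^3) set \<Rightarrow> vector_field \<Rightarrow> scalar_field" where
  "wdiv \<Omega> v = (SOME d. has_weak_div \<Omega> v d)"

definition Hgrad :: "(real^3) set \<Rightarrow> scalar_field set" where
  "Hgrad \<Omega> = {q \<in> L2 \<Omega>. \<exists>g. has_weak_grad \<Omega> q g}"

definition Hcurl :: "(real^3) set \<Rightarrow> vector_field set" where
  "Hcurl \<Omega> = {v \<in> L2 \<Omega>. \<exists>w. has_weak_curl \<Omega> v w}"

definition Hdiv :: "(real^3) set \<Rightarrow> vector_field set" where
  "Hdiv \<Omega> = {v \<in> L2 \<Omega>. \<exists>d. has_weak_div \<Omega> v d}"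


section \<open>Traces\<close>

text \<open>The traces \<open>q\<close>, \<open>v \<times> n\<close> and \<open>v \<bullet> n\<close> on the boundary are the functionals given by Green's
  formula: for a smooth field and outer unit normal \<open>n\<close> they are the surface integrals of
  \<open>q (\<phi> \<bullet> n)\<close>, \<open>(v \<times> n) \<bullet> \<phi>\<close> and \<open>(v \<bullet> n) \<phi>\<close>, respectively. The
  argument \<open>\<phi>\<close> ranges over all fields smooth up to the boundary, with no support condition.\<close>

definition grad_trace :: "(real^3) set \<Rightarrow> scalar_field \<Rightarrow> vector_field \<Rightarrow> real" where
  "grad_trace \<Omega> q \<phi> = ip \<Omega> q (cdiv \<phi>) + ip \<Omega> (wgrad \<Omega> q) \<phi>"

definition tangential_trace :: "(real^3) set \<Rightarrow> vector_field \<Rightarrow> vector_field \<Rightarrow> real" where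
  "tangential_trace \<Omega> v \<phi> = ip \<Omega> v (ccurl \<phi>) - ip \<Omega> (wcurl \<Omega> v) \<phi>"

definition normal_trace :: "(real^3) set \<Rightarrow> vector_field \<Rightarrow> scalar_field \<Rightarrow> real" where
  "normal_trace \<Omega> v \<phi> = ip \<Omega> v (cgrad \<phi>) + ip \<Omega> (wdiv \<Omega> v) \<phi>"

definition H0grad :: "(real^3) set \<Rightarrow> scalar_field set" where
  "H0grad \<Omega> = {q \<in> Hgrad \<Omega>. \<forall>\<phi>. smooth \<phi> \<longrightarrow> grad_trace \<Omega> q \<phi> = 0}"

definition H0curl :: "(real^3) set \<Rightarrow> vector_field set" where
  "H0curl \<Omega> = {v \<in> Hcurl \<Omega>. \<forall>\<phi>. smooth \<phi> \<longrightarrow> tangential_trace \<Omega> v \<phi> = 0}"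

definition H0div :: "(real^3) set \<Rightarrow> vector_field set" where
  "H0div \<Omega> = {v \<in> Hdiv \<Omega>. \<forall>\<phi>. smooth \<phi> \<longrightarrow> normal_trace \<Omega> v \<phi> = 0}"

definition L20 :: "(real^3) set \<Rightarrow> scalar_field set" where
  "L20 \<Omega> = {q \<in> L2 \<Omega>. (LINT x|lebesgue_on \<Omega>. q x) = 0}"


section \<open>Finite element spaces and the discrete de Rham complex\<close>

text \<open>A finite partition of the domain into open cells, up to a null set; the shape of the cells is not
  restricted.\<close>

definition is_mesh :: "(real^3) set \<Rightarrow> (real^3) set set \<Rightarrow> bool" where
  "is_mesh \<Omega> \<K> \<longleftrightarrow>
     finite \<K> \<and> disjoint \<K> \<and> (\<forall>K\<in>\<K>. open K \<and> K \<noteq> {} \<and> K \<subseteq> \<Omega>) \<and> negligible (\<Omega> - \<Union>\<K>)"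

definition piecewise_poly :: "(real^3) set set \<Rightarrow> (real^3 \<Rightarrow> 'b::euclidean_space) \<Rightarrow> bool" where
  "piecewise_poly \<K> v \<longleftrightarrow> (\<forall>K\<in>\<K>. \<exists>p. polynomial_function p \<and> ae_eq K v p)"

text \<open>\<open>V\<close> is the full set of representatives of a finite-dimensional subspace of \<open>L\<^sup>2\<close>.\<close>

definition fin_dim_subspace :: "(real^3) set \<Rightarrow> (real^3 \<Rightarrow> 'b::euclidean_space) set \<Rightarrow> bool" where
  "fin_dim_subspace \<Omega> V \<longleftrightarrow>
     (\<exists>\<B>. finite \<B> \<and> \<B> \<subseteq> L2 \<Omega> \<and>
        V = {v \<in> L2 \<Omega>. \<exists>c. ae_eq \<Omega> v (\<lambda>x. \<Sum>b\<in>\<B>. c b *\<^sub>R b x)})"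

definition fe_subspace ::
  "(real^3) set \<Rightarrow> (real^3) set set \<Rightarrow> (real^3 \<Rightarrow> 'b::euclidean_space) set \<Rightarrow> (real^3 \<Rightarrow> 'b) set \<Rightarrow> bool"
  where
  "fe_subspace \<Omega> \<K> X V \<longleftrightarrow> fin_dim_subspace \<Omega> V \<and> V \<subseteq> X \<and> (\<forall>v\<in>V. piecewise_poly \<K> v)"

text \<open>The equalities of sets contain both the complex property (the differentials
  map each space into the next one) and exactness.\<close>

definition discrete_de_rham ::
  "(real^3) set \<Rightarrow> scalar_field set \<Rightarrow> vector_field set \<Rightarrow> vector_field set \<Rightarrow> scalar_field set \<Rightarrow> bool"
  where
  "discrete_de_rham \<Omega> Vg Vc Vd V0 \<longleftrightarrow>
     (\<exists>\<K>. is_mesh \<Omega> \<K> \<and> fe_subspace \<Omega> \<K> (H0grad \<Omega>) Vg \<and> fe_subspace \<Omega> \<K> (H0curl \<Omega>) Vc \<and>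
          fe_subspace \<Omega> \<K> (H0div \<Omega>) Vd \<and> fe_subspace \<Omega> \<K> (L20 \<Omega>) V0) \<and>
     (\<forall>q\<in>Vg. ae_eq \<Omega> (wgrad \<Omega> q) (\<lambda>_. 0) \<longrightarrow> ae_eq \<Omega> q (\<lambda>_. 0)) \<and>
     {w. \<exists>q\<in>Vg. ae_eq \<Omega> w (wgrad \<Omega> q)} = {v \<in> Vc. ae_eq \<Omega> (wcurl \<Omega> v) (\<lambda>_. 0)} \<and>
     {w. \<exists>v\<in>Vc. ae_eq \<Omega> w (wcurl \<Omega> v)} = {v \<in> Vd. ae_eq \<Omega> (wdiv \<Omega> v) (\<lambda>_. 0)} \<and>
     {d. \<exists>v\<in>Vd. ae_eq \<Omega> d (wdiv \<Omega> v)} = V0"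


section \<open>The fully discrete scheme\<close>

text \<open>Sequences of fields at integer time levels are differenced and averaged over the
  step from level \<open>n\<close> to \<open>n + 1\<close>; for unknowns living at midpoints, index \<open>n\<close> stands for the
  level \<open>n + 1/2\<close>.\<close>

definition Dt :: "real \<Rightarrow> (nat \<Rightarrow> vector_field) \<Rightarrow> nat \<Rightarrow> vector_field" where
  "Dt \<tau> a n x = (1 / \<tau>) *\<^sub>R (a (Suc n) x - a n x)"

definition mid :: "(nat \<Rightarrow> vector_field) \<Rightarrow> nat \<Rightarrow> vector_field" where
  "mid a n x = (1 / 2) *\<^sub>R (a (Suc n) x + a n x)"

definition Dt_int :: "(real^3) set \<Rightarrow> real \<Rightarrow> (nat \<Rightarrow> vector_field) \<Rightarrow> (nat \<Rightarrow> vector_field) \<Rightarrow> nat \<Rightarrow> real"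
  where
  "Dt_int \<Omega> \<tau> a b n =
     (1 / \<tau>) * ((LINT x|lebesgue_on \<Omega>. a (Suc n) x \<bullet> b (Suc n) x) - (LINT x|lebesgue_on \<Omega>. a n x \<bullet> b n x))"

text \<open>For Reynolds numbers; on extended reals \<open>inverse \<infinity> = 0\<close>.\<close>

definition rinv :: "ereal \<Rightarrow> real" where
  "rinv R = real_of_ereal (inverse R)"

definition fmid :: "real \<Rightarrow> (real \<Rightarrow> vector_field) \<Rightarrow> nat \<Rightarrow> vector_field" where
  "fmid \<tau> f n = f ((real n + 1 / 2) * \<tau>)"

definition mhd_solution ::
  "(real^3) set \<Rightarrow> scalar_field set \<Rightarrow> vector_field set \<Rightarrow> vector_field set \<Rightarrow>
   real \<Rightarrow> real \<Rightarrow> ereal \<Rightarrow> ereal \<Rightarrow> (real \<Rightarrow> vector_field) \<Rightarrow>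
   (nat \<Rightarrow> vector_field) \<Rightarrow> (nat \<Rightarrow> vector_field) \<Rightarrow> (nat \<Rightarrow> vector_field) \<Rightarrow> (nat \<Rightarrow> vector_field) \<Rightarrow>
   (nat \<Rightarrow> vector_field) \<Rightarrow> (nat \<Rightarrow> vector_field) \<Rightarrow> (nat \<Rightarrow> scalar_field) \<Rightarrow> bool"
  where
  "mhd_solution \<Omega> Vg Vc Vd \<tau> c R\<^sub>e R\<^sub>m f u B \<omega> j E H P \<longleftrightarrow>
     (\<forall>n. u n \<in> Vc \<and> B n \<in> Vd \<and> \<omega> n \<in> Vc \<and> j n \<in> Vc \<and> E n \<in> Vc \<and> H n \<in> Vc \<and> P n \<in> Vg) \<and>
     (\<forall>n.
       (\<forall>v\<in>Vc. ip \<Omega> (Dt \<tau> u n) v - ip \<Omega> (\<lambda>x. cross3 (mid u n x) (\<omega> n x)) v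
                + rinv R\<^sub>e * ip \<Omega> (wcurl \<Omega> (mid u n)) (wcurl \<Omega> v) + ip \<Omega> (wgrad \<Omega> (P n)) v
                - c * ip \<Omega> (\<lambda>x. cross3 (j n x) (H n x)) v = ip \<Omega> (fmid \<tau> f n) v) \<and>
       (\<forall>C\<in>Vd. ip \<Omega> (Dt \<tau> B n) C + ip \<Omega> (wcurl \<Omega> (E n)) C = 0) \<and>
       (\<forall>G\<in>Vc. ip \<Omega> (\<lambda>x. rinv R\<^sub>m *\<^sub>R j n x - (E n x + cross3 (mid u n x) (H n x))) G = 0) \<and>
       (\<forall>\<mu>\<in>Vc. ip \<Omega> (\<omega> n) \<mu> - ip \<Omega> (wcurl \<Omega> (mid u n)) \<mu> = 0) \<and>
       (\<forall>k\<in>Vc. ip \<Omega> (j n) k - ip \<Omega> (mid B n) (wcurl \<Omega> k) = 0) \<and>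
       (\<forall>F\<in>Vc. ip \<Omega> (mid B n) F - ip \<Omega> (H n) F = 0) \<and>
       (\<forall>Q\<in>Vg. ip \<Omega> (mid u n) (wgrad \<Omega> Q) = 0))"

end

theory Submission
  imports Defs "HOL-Probability.Distributions"
begin

text \<open>
  By polarisation the discrete time derivative of the cross helicity is
  \<open>(D\<^sub>t u, B) + (u, D\<^sub>t B)\<close>, all other fields being taken at the midpoint.

  In the first term the \<open>L\<^sup>2\<close> projection that defines \<open>H\<close>, tested with \<open>D\<^sub>t u\<close>, replaces \<open>B\<close> by \<open>H\<close>,
  and \<open>H\<close> is an admissible test function in the momentum equation. The Lorentz force \<open>j \<times> H\<close>
  does no work against \<open>H\<close>. The pressure gradient lies in the discrete curl space, so the
  projection also turns \<open>(\<nabla>P, H)\<close> into \<open>(\<nabla>P, B)\<close>. This vanishes because \<open>B\<close> stays orthogonal to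
  discrete gradients: the initial field is the curl of a discrete field by exactness, each step
  of Faraday's law adds only a multiple of such a curl, and these are orthogonal to gradients.
  What is left is the convection term \<open>(u \<times> \<omega>, H)\<close>, the viscous term and the source.

  For the second term, \<open>D\<^sub>t B + curl E\<close> belongs to the discrete div space and is orthogonal to that
  space by Faraday's law, hence vanishes almost everywhere. Thus \<open>(u, D\<^sub>t B) = - (u, curl E) =
  - (curl u, E) = - (\<omega>, E)\<close>, the last step by the definition of the discrete vorticity. Ohm's law
  tested with \<open>\<omega>\<close> and the vorticity equation tested with \<open>j\<close> turn this into
  \<open>- R\<^sub>m\<^sup>-\<^sup>1 (curl u, j) + (u \<times> H, \<omega>)\<close>, and the triple product cancels the convection term.

  The analytic ingredient is the symmetry \<open>(v, curl w) = (curl v, w)\<close> for two discrete fields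
  with vanishing tangential trace (lemma \<open>discrete_curl_symmetric\<close>). The definition of the trace
  gives this only when one of the fields is smooth. The proof uses a Gaussian kernel \<open>G\<^sub>s\<close>. Testing
  the weak curl of \<open>w\<close> with \<open>y \<mapsto> G\<^sub>s(y - x) v(x)\<close> and that of \<open>v\<close> with \<open>x \<mapsto> G\<^sub>s(x - y) w(y)\<close> leads
  to the same double integral, because the gradient of the kernel is odd and the triple product is
  alternating. Hence the symmetry holds with \<open>G\<^sub>s\<close> inserted between the two fields (lemma
  \<open>weak_curl_symmetric\<close>). Piecewise polynomial fields have bounded representatives that
  are continuous off a null set, so for a narrowing kernel both sides converge by dominated
  convergence (lemma \<open>gauss_pairing_tendsto\<close>).
\<close>

section \<open>Smoothness of Gaussian test fields\<close>

text \<open>Smoothness is a greatest fixed point: it can be shown by exhibiting a class of differentiable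
  functions closed under partial derivatives.\<close>

lemma smooth_coinduct:
  fixes S :: "(real^3 \<Rightarrow> 'b::real_normed_vector) set"
  assumes "\<And>f x. f \<in> S \<Longrightarrow> f differentiable (at x)"
    and "\<And>f i. f \<in> S \<Longrightarrow> pd i f \<in> S"
    and "f \<in> S"
  shows "smooth f"
proof -
  have "Ck k g" if "g \<in> S" for k g
    using that
  proof (induction k arbitrary: g)
    case 0
    then show ?case
      using assms(1) by (simp add: continuous_at_imp_continuous_on differentiable_imp_continuous_within)
  next
    case (Suc k)
    then show ?case
      using assms(1,2) by simp
  qed
  then show ?thesis
    using assms(3) by (simp add: smooth_def)
qed

lemma real_polynomial_has_polynomial_derivative:
  fixes p :: "'a::real_normed_vector \<Rightarrow> real"
  assumes "real_polynomial_function p"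
  shows "\<exists>D. (\<forall>x. (p has_derivative D x) (at x)) \<and> (\<forall>h. real_polynomial_function (\<lambda>x. D x h))"
  using assms
proof induction
  case (linear f)
  then show ?case
    by (intro exI[of _ "\<lambda>_. f"]) (auto intro: bounded_linear_imp_has_derivative real_polynomial_function.intros)
next
  case (const c)
  then show ?case
    by (intro exI[of _ "\<lambda>_ _. 0"]) (auto intro: real_polynomial_function.intros)
next
  case (add f g)
  then obtain D D' where "\<forall>x. (f has_derivative D x) (at x)" "\<forall>h. real_polynomial_function (\<lambda>x. D x h)"
    "\<forall>x. (g has_derivative D' x) (at x)" "\<forall>h. real_polynomial_function (\<lambda>x. D' x h)"
    by blast
  then show ?case
    by (intro exI[of _ "\<lambda>x h. D x h + D' x h"])
      (auto intro: has_derivative_add real_polynomial_function.intros)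
next
  case (mult f g)
  then obtain D D' where "\<forall>x. (f has_derivative D x) (at x)" "\<forall>h. real_polynomial_function (\<lambda>x. D x h)"
    "\<forall>x. (g has_derivative D' x) (at x)" "\<forall>h. real_polynomial_function (\<lambda>x. D' x h)"
    by blast
  with mult.hyps show ?case
    by (intro exI[of _ "\<lambda>x h. f x * D' x h + D x h * g x"])
      (auto intro!: has_derivative_mult real_polynomial_function.intros(3,4))
qed

text \<open>The products \<open>r exp q\<close> with \<open>q\<close> fixed and \<open>r\<close> an arbitrary polynomial form such a class, since
  the derivative of \<open>r exp q\<close> in direction \<open>h\<close> is \<open>(\<partial>\<^sub>h r + r \<partial>\<^sub>h q) exp q\<close>.\<close>

lemma smooth_polynomial_exp:
  fixes a :: "'b::real_normed_vector"
  assumes "real_polynomial_function p" and "real_polynomial_function q"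
  shows "smooth (\<lambda>y. (p y * exp (q y)) *\<^sub>R a)"
proof -
  define S where "S = {(\<lambda>y. (r y * exp (q y)) *\<^sub>R a) | r. real_polynomial_function r}"
  obtain D where D: "\<And>x. (q has_derivative D x) (at x)"
    "\<And>h. real_polynomial_function (\<lambda>x. D x h)"
    using real_polynomial_has_polynomial_derivative[OF assms(2)] by blast
  have step: "f differentiable (at x) \<and> pd i f \<in> S" if "f \<in> S" for f x i
  proof -
    obtain r where r: "real_polynomial_function r" and f: "f = (\<lambda>y. (r y * exp (q y)) *\<^sub>R a)"
      using \<open>f \<in> S\<close> by (auto simp: S_def)
    obtain C where C: "\<And>x. (r has_derivative C x) (at x)"
      "\<And>h. real_polynomial_function (\<lambda>x. C x h)"
      using real_polynomial_has_polynomial_derivative[OF r] by blast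
    have der: "(f has_derivative (\<lambda>h. ((C z h + r z * D z h) * exp (q z)) *\<^sub>R a)) (at z)" for z
      unfolding f
      by (rule has_derivative_eq_rhs) (rule derivative_intros C D | simp add: algebra_simps)+
    have "pd i f = (\<lambda>z. ((C z (axis i 1) + r z * D z (axis i 1)) * exp (q z)) *\<^sub>R a)"
      using frechet_derivative_at[OF der] by (auto simp: pd_def fun_eq_iff)
    moreover have "real_polynomial_function (\<lambda>z. C z (axis i 1) + r z * D z (axis i 1))"
      by (intro real_polynomial_function.intros C D r)
    ultimately show ?thesis
      using der by (auto simp: S_def differentiable_def)
  qed
  show ?thesis
    by (rule smooth_coinduct[of S]) (use step assms(1) in \<open>auto simp: S_def\<close>)
qed

section \<open>Gaussian mollification\<close>

text \<open>The kernel carries no normalising constant: the factors \<open>s ^ DIM('a)\<close> and the total mass appear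
  explicitly in the limits below, and of the mass only positivity matters.\<close>

definition gauss :: "real \<Rightarrow> 'a::euclidean_space \<Rightarrow> real" where
  "gauss s z = exp (- s\<^sup>2 * (z \<bullet> z))"

lemma gauss_pos: "0 < gauss s z"
  by (simp add: gauss_def)

lemma gauss_le_1: "gauss s z \<le> 1"
  by (simp add: gauss_def)

lemma gauss_minus_commute: "gauss s (x - y) = gauss s (y - x)"
  by (simp add: gauss_def algebra_simps inner_commute)

lemma measurable_gauss [measurable]: "gauss s \<in> borel_measurable borel"
  unfolding gauss_def[abs_def] by measurable

lemma integrable_gauss: "integrable lborel (gauss 1 :: 'a::euclidean_space \<Rightarrow> real)"
proof (rule integrableI_nonneg)
  have "(\<lambda>x::real. exp (- x\<^sup>2)) = (\<lambda>x. sqrt pi * normal_density 0 (1 / sqrt 2) x)"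
    by (simp add: normal_density_def power_divide fun_eq_iff)
  then have "integrable lborel (\<lambda>x::real. exp (- x\<^sup>2))"
    by (simp add: integrable_normal_density)
  then have fin: "(\<integral>\<^sup>+x. ennreal (exp (- (x::real)\<^sup>2)) \<partial>lborel) < \<infinity>"
    by (simp add: integrable_iff_bounded)
  \<comment> \<open>The kernel factorises over the coordinates, so its integrability is that of the normal density.\<close>
  have "gauss 1 x = (\<Prod>b\<in>Basis. exp (- (x \<bullet> b)\<^sup>2))" for x :: 'a
    by (simp add: gauss_def euclidean_inner[of x x] power2_eq_square sum_negf exp_sum[symmetric])
  then have "(\<integral>\<^sup>+x. ennreal (gauss 1 (x::'a)) \<partial>lborel) =
      (\<integral>\<^sup>+x. (\<Prod>b\<in>Basis. ennreal (exp (- ((x::'a) \<bullet> b)\<^sup>2))) \<partial>lborel)"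
    by (simp add: prod_ennreal)
  also have "\<dots> = (\<Prod>b\<in>(Basis::'a set). (\<integral>\<^sup>+x. ennreal (exp (- (x::real)\<^sup>2)) \<partial>lborel))"
    by (rule nn_integral_lborel_prod) auto
  also have "\<dots> < \<infinity>"
    using fin by (simp add: power_less_top_ennreal)
  finally show "(\<integral>\<^sup>+x. ennreal (gauss 1 (x::'a)) \<partial>lborel) < \<infinity>" .
qed (auto simp: gauss_pos less_imp_le)

lemma integral_gauss_pos: "0 < (\<integral>z. gauss 1 z \<partial>(lborel :: 'a::euclidean_space measure))"
proof -
  have "gauss 1 z \<noteq> 0" for z :: 'a
    using gauss_pos[of 1 z] by simp
  then have "\<not> (AE z in (lborel :: 'a measure). gauss 1 z = 0)"
    by (simp add: AE_iff_null null_sets_def)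
  then have "(\<integral>z. gauss 1 z \<partial>(lborel :: 'a measure)) \<noteq> 0"
    using integral_nonneg_eq_0_iff_AE[OF integrable_gauss] by (auto simp: gauss_pos less_imp_le)
  then show ?thesis
    by (simp add: less_le gauss_pos[THEN less_imp_le] integral_nonneg)
qed

text \<open>After the substitution \<open>y = x + z / s\<close> the parameter sits only in the argument of \<open>b\<close>, which is
  the form suited to dominated convergence.\<close>

lemma gauss_convolution_rescale:
  fixes b :: "'a::euclidean_space \<Rightarrow> 'b::euclidean_space"
  assumes [measurable]: "b \<in> borel_measurable borel" and "s > 0"
  shows "(\<integral>y. gauss s (y - x) *\<^sub>R b y \<partial>lborel) =
    (1 / s ^ DIM('a)) *\<^sub>R (\<integral>z. gauss 1 z *\<^sub>R b (x + (1 / s) *\<^sub>R z) \<partial>lborel)"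
proof -
  have "(\<integral>y. gauss s (y - x) *\<^sub>R b y \<partial>lborel) =
     (\<integral>y. gauss s (y - x) *\<^sub>R b y
        \<partial>density (distr lborel borel (\<lambda>z. x + (1 / s) *\<^sub>R z)) (\<lambda>_. ennreal (\<bar>1 / s\<bar> ^ DIM('a))))"
    using lborel_affine[of "1 / s" x] \<open>s > 0\<close> by simp
  also have "\<dots> = (\<integral>z. \<bar>1 / s\<bar> ^ DIM('a) *\<^sub>R
      (gauss s ((1 / s) *\<^sub>R z) *\<^sub>R b (x + (1 / s) *\<^sub>R z)) \<partial>lborel)"
    by (subst integral_density) (auto simp: integral_distr)
  also have "\<dots> = (\<integral>z. (1 / s ^ DIM('a)) *\<^sub>R (gauss 1 z *\<^sub>R b (x + (1 / s) *\<^sub>R z)) \<partial>lborel)"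
    using \<open>s > 0\<close> by (intro Bochner_Integration.integral_cong)
      (auto simp: gauss_def power_divide power2_eq_square)
  also have "\<dots> = (1 / s ^ DIM('a)) *\<^sub>R (\<integral>z. gauss 1 z *\<^sub>R b (x + (1 / s) *\<^sub>R z) \<partial>lborel)"
    by (rule Bochner_Integration.integral_scaleR_right)
  finally show ?thesis .
qed

lemma gauss_convolution_tendsto:
  fixes b :: "'a::euclidean_space \<Rightarrow> 'b::euclidean_space"
  assumes [measurable]: "b \<in> borel_measurable borel" and bound: "\<And>y. norm (b y) \<le> M"
    and cont: "isCont b x"
  shows "(\<lambda>n. \<integral>z. gauss 1 z *\<^sub>R b (x + (1 / real (Suc n)) *\<^sub>R z) \<partial>lborel)
    \<longlonglongrightarrow> (\<integral>z. gauss 1 z \<partial>(lborel :: 'a measure)) *\<^sub>R b x"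
proof -
  have "(\<lambda>n. \<integral>z. gauss 1 z *\<^sub>R b (x + (1 / real (Suc n)) *\<^sub>R z) \<partial>lborel)
    \<longlonglongrightarrow> (\<integral>z. gauss 1 z *\<^sub>R b x \<partial>(lborel :: 'a measure))"
  proof (rule integral_dominated_convergence[where w="\<lambda>z. gauss 1 z * M"])
    show "integrable lborel (\<lambda>z::'a. gauss 1 z * M)"
      by (simp add: integrable_gauss)
    show "AE z in lborel. (\<lambda>n. gauss 1 z *\<^sub>R b (x + (1 / real (Suc n)) *\<^sub>R z)) \<longlonglongrightarrow> gauss 1 z *\<^sub>R b x"
    proof (rule AE_I2)
      fix z :: 'a
      have "(\<lambda>n. x + (1 / real (Suc n)) *\<^sub>R z) \<longlonglongrightarrow> x + 0 *\<^sub>R z"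
        by (intro tendsto_intros LIMSEQ_Suc lim_1_over_n)
      then have "(\<lambda>n. b (x + (1 / real (Suc n)) *\<^sub>R z)) \<longlonglongrightarrow> b x"
        using isCont_tendsto_compose[OF cont] by simp
      then show "(\<lambda>n. gauss 1 z *\<^sub>R b (x + (1 / real (Suc n)) *\<^sub>R z)) \<longlonglongrightarrow> gauss 1 z *\<^sub>R b x"
        by (intro tendsto_intros)
    qed
    show "AE z in lborel. norm (gauss 1 z *\<^sub>R b (x + (1 / real (Suc n)) *\<^sub>R z)) \<le> gauss 1 z * M" for n
      by (auto simp: gauss_pos less_imp_le abs_of_pos intro!: mult_left_mono bound)
  qed measurable
  then show ?thesis
    by (simp add: integrable_gauss)
qed

lemma gauss_convolution_norm_le:
  fixes b :: "'a::euclidean_space \<Rightarrow> 'b::euclidean_space"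
  assumes [measurable]: "b \<in> borel_measurable borel" and bound: "\<And>y. norm (b y) \<le> M"
  shows "norm (\<integral>z. gauss 1 z *\<^sub>R b (x + t *\<^sub>R z) \<partial>lborel) \<le>
    (\<integral>z. gauss 1 z \<partial>(lborel :: 'a measure)) * M"
proof -
  have le: "norm (gauss 1 z *\<^sub>R b (x + t *\<^sub>R z)) \<le> gauss 1 z * M" for z
    by (auto simp: gauss_pos less_imp_le abs_of_pos intro!: mult_left_mono bound)
  have "norm (\<integral>z. gauss 1 z *\<^sub>R b (x + t *\<^sub>R z) \<partial>lborel) \<le> (\<integral>z. gauss 1 z * M \<partial>(lborel :: 'a measure))"
  proof (rule Bochner_Integration.integral_norm_bound_integral)
    show "integrable lborel (\<lambda>z::'a. gauss 1 z * M)"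
      by (simp add: integrable_gauss)
    then show "integrable lborel (\<lambda>z. gauss 1 z *\<^sub>R b (x + t *\<^sub>R z))"
      by (rule Bochner_Integration.integrable_bound)
        (auto intro!: AE_I2 order_trans[OF le] simp del: norm_scaleR)
  qed (rule le)
  then show ?thesis
    by simp
qed

text \<open>The representatives on which mollification converges pointwise. Functions vanish off \<open>S\<close>, so
  integrals over \<open>S\<close> become integrals over the whole space.\<close>

definition regular_on :: "'a::euclidean_space set \<Rightarrow> ('a \<Rightarrow> 'b::euclidean_space) \<Rightarrow> bool" where
  "regular_on S b \<longleftrightarrow> b \<in> borel_measurable borel \<and> bounded (range b) \<and>
     (\<forall>x. x \<notin> S \<longrightarrow> b x = 0) \<and> (AE x in lborel. x \<in> S \<longrightarrow> isCont b x)"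

lemma regular_onD:
  assumes "regular_on S b"
  shows "b \<in> borel_measurable borel" and "\<And>x. x \<notin> S \<Longrightarrow> b x = 0"
    and "AE x in lborel. x \<in> S \<longrightarrow> isCont b x"
    and "\<exists>M\<ge>0. \<forall>x. norm (b x) \<le> M"
  using assms by (auto simp: regular_on_def bounded_pos intro: less_imp_le)

text \<open>Mollifying \<open>b\<close> recovers it at every continuity point, hence almost everywhere, and never
  exceeds the bound on \<open>b\<close> times the mass of the kernel; since \<open>a\<close> is bounded with bounded support,
  dominated convergence passes to the limit in the outer integral.\<close>

lemma gauss_pairing_tendsto:
  fixes a b :: "'a::euclidean_space \<Rightarrow> 'b::euclidean_space"
  assumes S: "open S" "bounded S" and a: "regular_on S a" and b: "regular_on S b"
  shows "(\<lambda>n. real (Suc n) ^ DIM('a) *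
      (\<integral>x. (\<integral>y. gauss (real (Suc n)) (y - x) * (a x \<bullet> b y) \<partial>lborel) \<partial>lborel))
    \<longlonglongrightarrow> (\<integral>z. gauss 1 z \<partial>(lborel :: 'a measure)) * (\<integral>x. a x \<bullet> b x \<partial>lborel)"
proof -
  note [measurable] = regular_onD(1)[OF a] regular_onD(1)[OF b]
  obtain M where M: "M \<ge> 0" "\<And>x. norm (a x) \<le> M"
    using regular_onD(4)[OF a] by blast
  obtain N where N: "N \<ge> 0" "\<And>x. norm (b x) \<le> N"
    using regular_onD(4)[OF b] by blast
  define C where "C = (\<integral>z. gauss 1 z \<partial>(lborel :: 'a measure))"
  have C: "C > 0"
    unfolding C_def by (rule integral_gauss_pos)
  define b' where "b' n x = (\<integral>z. gauss 1 z *\<^sub>R b (x + (1 / real (Suc n)) *\<^sub>R z) \<partial>lborel)" for n x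
  have meas [measurable]: "b' n \<in> borel_measurable borel" for n
    unfolding b'_def by measurable
  have int: "integrable lborel (\<lambda>y. gauss (real (Suc n)) (y - x) *\<^sub>R b y)" for n x
  proof (rule integrableI_bounded_set[of S _ _ N])
    show "AE y in lborel. y \<in> S \<longrightarrow> norm (gauss (real (Suc n)) (y - x) *\<^sub>R b y) \<le> N"
      by (auto simp: abs_of_pos[OF gauss_pos] intro!: AE_I2 mult_le_one
        order_trans[OF mult_mono[OF gauss_le_1 N(2)]])
  qed (use S emeasure_bounded_finite[of S] regular_onD(2)[OF b] in auto)
  have "real (Suc n) ^ DIM('a) * (\<integral>x. (\<integral>y. gauss (real (Suc n)) (y - x) * (a x \<bullet> b y) \<partial>lborel) \<partial>lborel)
      = (\<integral>x. a x \<bullet> b' n x \<partial>lborel)" for n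
  proof -
    have "(\<integral>y. gauss (real (Suc n)) (y - x) * (a x \<bullet> b y) \<partial>lborel) =
        (1 / real (Suc n) ^ DIM('a)) * (a x \<bullet> b' n x)" for x
    proof -
      have "(\<integral>y. gauss (real (Suc n)) (y - x) * (a x \<bullet> b y) \<partial>lborel) =
          (\<integral>y. a x \<bullet> (gauss (real (Suc n)) (y - x) *\<^sub>R b y) \<partial>lborel)"
        by simp
      also have "\<dots> = a x \<bullet> (\<integral>y. gauss (real (Suc n)) (y - x) *\<^sub>R b y \<partial>lborel)"
        by (rule integral_inner_right) (rule int)
      also have "\<dots> = (1 / real (Suc n) ^ DIM('a)) * (a x \<bullet> b' n x)"
        by (subst gauss_convolution_rescale) (simp_all add: b'_def)
      finally show ?thesis .
    qed
    then show ?thesis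
      by simp
  qed
  moreover have "(\<lambda>n. \<integral>x. a x \<bullet> b' n x \<partial>lborel) \<longlonglongrightarrow> (\<integral>x. a x \<bullet> (C *\<^sub>R b x) \<partial>lborel)"
  proof (rule integral_dominated_convergence[where w="\<lambda>x. M * (C * N) * indicator S x"])
    show "integrable lborel (\<lambda>x. M * (C * N) * indicator S x :: real)"
      using S emeasure_bounded_finite[of S] by (simp add: less_top)
    show "AE x in lborel. (\<lambda>n. a x \<bullet> b' n x) \<longlonglongrightarrow> a x \<bullet> (C *\<^sub>R b x)"
      using regular_onD(3)[OF b]
    proof eventually_elim
      case (elim x)
      show ?case
      proof (cases "x \<in> S")
        case True
        then show ?thesis
          unfolding b'_def C_def using elim N(2)
          by (intro tendsto_inner tendsto_const gauss_convolution_tendsto) auto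
      next
        case False
        then show ?thesis
          by (simp add: regular_onD(2)[OF a])
      qed
    qed
    show "AE x in lborel. norm (a x \<bullet> b' n x) \<le> M * (C * N) * indicator S x" for n
    proof (rule AE_I2)
      fix x
      have "norm (b' n x) \<le> C * N"
        unfolding b'_def C_def by (rule gauss_convolution_norm_le) (auto simp: N(2))
      then have "norm (a x \<bullet> b' n x) \<le> M * (C * N)"
        using M N C by (intro order_trans[OF Cauchy_Schwarz_ineq2[THEN eq_refl[OF real_norm_def, THEN order_trans]]] mult_mono) auto
      then show "norm (a x \<bullet> b' n x) \<le> M * (C * N) * indicator S x"
        by (cases "x \<in> S") (simp_all add: regular_onD(2)[OF a])
    qed
  qed measurable
  ultimately show ?thesis
    by (simp add: C_def)
qed

section \<open>Symmetry of the weak curl\<close>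

lemma ccurl_gauss:
  "ccurl (\<lambda>y. gauss s (y - x) *\<^sub>R a) y = (- 2 * s\<^sup>2 * gauss s (y - x)) *\<^sub>R cross3 (y - x) a"
proof -
  have "((\<lambda>y. gauss s (y - x) *\<^sub>R a) has_derivative
      (\<lambda>h. (- 2 * s\<^sup>2 * gauss s (y - x) * ((y - x) \<bullet> h)) *\<^sub>R a)) (at y)"
    unfolding gauss_def
    by (rule has_derivative_eq_rhs) (rule derivative_intros | simp add: algebra_simps inner_commute)+
  note der = frechet_derivative_at[OF this, symmetric]
  have "pd i (\<lambda>y. gauss s (y - x) *\<^sub>R a) y = (- 2 * s\<^sup>2 * gauss s (y - x) * ((y - x) $ i)) *\<^sub>R a" for i
    unfolding pd_def der by (simp add: inner_axis)
  then show ?thesis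
    by (simp only: ccurl_def cross3_def vec_eq_iff forall_3 vector_3 vector_scaleR_component) (simp add: algebra_simps)
qed

lemma smooth_gauss:
  fixes x :: "real^3" and a :: "'b::real_normed_vector"
  shows "smooth (\<lambda>y. gauss s (y - x) *\<^sub>R a)"
proof -
  have "real_polynomial_function (\<lambda>y. - s\<^sup>2 * ((y - x) \<bullet> (y - x)))"
  proof -
    have "real_polynomial_function (\<lambda>y. (y - x) $ i)" for i
      using real_polynomial_function_diff[of "\<lambda>y. y $ i" "\<lambda>_. x $ i"]
      by (simp add: real_polynomial_function.intros bounded_linear_vec_nth)
    then show ?thesis
      unfolding inner_vec_def inner_real_def
      by (intro real_polynomial_function.intros(2,4) real_polynomial_function_sum finite)
  qed
  from smooth_polynomial_exp[OF real_polynomial_function.intros(2)[of 1] this, of a] show ?thesis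
    by (simp add: gauss_def)
qed

lemma integrable_pair_bounded:
  fixes K :: "'a::euclidean_space \<Rightarrow> 'a \<Rightarrow> 'b::euclidean_space"
  assumes "open S" "bounded S"
    and [measurable]: "case_prod K \<in> borel_measurable (lborel \<Otimes>\<^sub>M lborel)"
    and "\<And>x y. x \<in> S \<Longrightarrow> y \<in> S \<Longrightarrow> norm (K x y) \<le> M"
    and "\<And>x y. x \<notin> S \<or> y \<notin> S \<Longrightarrow> K x y = 0"
  shows "integrable (lborel \<Otimes>\<^sub>M lborel) (case_prod K)"
proof (rule integrableI_bounded_set[of "S \<times> S" _ _ M])
  show "S \<times> S \<in> sets (lborel \<Otimes>\<^sub>M lborel)"
    using assms(1) by (auto intro!: pair_measureI)
  show "emeasure (lborel \<Otimes>\<^sub>M lborel) (S \<times> S) < \<infinity>"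
    using assms(1,2) emeasure_bounded_finite[of S]
    by (subst lborel.emeasure_pair_measure_Times) (auto simp: ennreal_mult_less_top)
qed (use assms in \<open>auto intro!: AE_I2\<close>)

lemma norm_cross3_le: "norm (cross3 x y) \<le> norm x * norm y"
proof (rule power2_le_imp_le)
  show "(norm (cross3 x y))\<^sup>2 \<le> (norm x * norm y)\<^sup>2"
    by (simp add: norm_cross power_mult_distrib)
qed simp

lemma measurable_cross3 [measurable (raw)]:
  assumes "f \<in> borel_measurable M" and "g \<in> borel_measurable M"
  shows "(\<lambda>x. cross3 (f x) (g x)) \<in> borel_measurable M"
  using assms
  by (rule borel_measurable_continuous_Pair) (intro continuous_on_cross continuous_intros)

text \<open>The weak identities are required for test fields without any support condition; this
  encodes the vanishing tangential trace and admits Gaussians as test fields.\<close>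

lemma weak_curl_symmetric:
  fixes v w cv cw :: vector_field
  assumes S: "open S" "bounded S"
    and v: "regular_on S v" and cv: "regular_on S cv" and w: "regular_on S w" and cw: "regular_on S cw"
    and curl_v: "\<And>\<phi>. smooth \<phi> \<Longrightarrow> (\<integral>x. v x \<bullet> ccurl \<phi> x \<partial>lborel) = (\<integral>x. cv x \<bullet> \<phi> x \<partial>lborel)"
    and curl_w: "\<And>\<phi>. smooth \<phi> \<Longrightarrow> (\<integral>x. w x \<bullet> ccurl \<phi> x \<partial>lborel) = (\<integral>x. cw x \<bullet> \<phi> x \<partial>lborel)"
  shows "(\<integral>x. v x \<bullet> cw x \<partial>lborel) = (\<integral>x. cv x \<bullet> w x \<partial>lborel)"
proof -
  note [measurable] = v[THEN regular_onD(1)] w[THEN regular_onD(1)]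
  obtain M where M: "M \<ge> 0" "\<And>x. norm (v x) \<le> M"
    using regular_onD(4)[OF v] by blast
  obtain N where N: "N \<ge> 0" "\<And>x. norm (w x) \<le> N"
    using regular_onD(4)[OF w] by blast
  obtain R where R: "\<And>x. x \<in> S \<Longrightarrow> norm x \<le> R"
    using S(2) by (auto simp: bounded_iff)
  have eq: "(\<integral>x. (\<integral>y. gauss s (y - x) * (v x \<bullet> cw y) \<partial>lborel) \<partial>lborel) =
      (\<integral>x. (\<integral>y. gauss s (y - x) * (w x \<bullet> cv y) \<partial>lborel) \<partial>lborel)" for s
  proof -
    define K where "K x y = (- 2 * s\<^sup>2 * gauss s (y - x)) * (w y \<bullet> cross3 (y - x) (v x))" for x y
    \<comment> \<open>Read for fixed \<open>x\<close>, the kernel \<open>K\<close> is \<open>w\<close> against the curl of a Gaussian multiple of \<open>v x\<close>;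
      read for fixed \<open>y\<close>, it is \<open>v\<close> against the curl of a Gaussian multiple of \<open>w y\<close>.\<close>
    have swap: "K x y = (- 2 * s\<^sup>2 * gauss s (x - y)) * (v x \<bullet> cross3 (x - y) (w y))" for x y
    proof -
      have "w y \<bullet> cross3 (y - x) (v x) = v x \<bullet> cross3 (x - y) (w y)"
        by (simp add: cross3_simps)
      then show ?thesis
        by (simp add: K_def gauss_minus_commute)
    qed
    have int: "integrable (lborel \<Otimes>\<^sub>M lborel) (case_prod K)"
    proof (rule integrable_pair_bounded[OF S])
      show "case_prod K \<in> borel_measurable (lborel \<Otimes>\<^sub>M lborel)"
        unfolding K_def by measurable
      fix x y
      show "K x y = 0" if "x \<notin> S \<or> y \<notin> S"
        using that regular_onD(2)[OF v, of x] regular_onD(2)[OF w, of y] by (auto simp: K_def)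
      assume xy: "x \<in> S" "y \<in> S"
      have "\<bar>w y \<bullet> cross3 (y - x) (v x)\<bar> \<le> norm (w y) * (norm (y - x) * norm (v x))"
        by (intro order_trans[OF Cauchy_Schwarz_ineq2] mult_left_mono norm_cross3_le) auto
      also have "\<dots> \<le> N * ((R + R) * M)"
        using M N R[OF xy(1)] R[OF xy(2)] norm_triangle_ineq4[of y x]
        by (intro mult_mono) (auto intro: order_trans[OF norm_ge_zero])
      finally have "\<bar>w y \<bullet> cross3 (y - x) (v x)\<bar> \<le> N * ((R + R) * M)" .
      moreover have "\<bar>- 2 * s\<^sup>2 * gauss s (y - x)\<bar> \<le> 2 * s\<^sup>2"
        using gauss_pos[of s "y - x"] gauss_le_1[of s "y - x"] by (auto simp: abs_mult mult_left_le)
      ultimately show "norm (K x y) \<le> 2 * s\<^sup>2 * (N * ((R + R) * M))"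
        unfolding K_def real_norm_def abs_mult[of _ "w y \<bullet> _"] by (intro mult_mono) auto
    qed
    have "(\<integral>y. gauss s (y - x) * (v x \<bullet> cw y) \<partial>lborel) = (\<integral>y. K x y \<partial>lborel)" for x
      using curl_w[OF smooth_gauss[of s x "v x"]]
      by (simp add: ccurl_gauss K_def inner_commute[of "v x"])
    moreover have "(\<integral>x. gauss s (x - y) * (w y \<bullet> cv x) \<partial>lborel) = (\<integral>x. K x y \<partial>lborel)" for y
      using curl_v[OF smooth_gauss[of s y "w y"]]
      by (simp add: ccurl_gauss swap inner_commute[of "w y"])
    ultimately show ?thesis
      using lborel_pair.Fubini_integral[OF int] by simp
  qed
  have "(\<integral>z. gauss 1 z \<partial>(lborel :: (real^3) measure)) * (\<integral>x. v x \<bullet> cw x \<partial>lborel) =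
      (\<integral>z. gauss 1 z \<partial>(lborel :: (real^3) measure)) * (\<integral>x. w x \<bullet> cv x \<partial>lborel)"
    using gauss_pairing_tendsto[OF S v cw] gauss_pairing_tendsto[OF S w cv]
    unfolding eq by (rule LIMSEQ_unique)
  then show ?thesis
    using integral_gauss_pos[where 'a="real^3"] by (simp add: inner_commute)
qed

section \<open>Piecewise polynomial fields\<close>

lemma borel_measurable_lebesgue_on:
  fixes f :: "'a::euclidean_space \<Rightarrow> 'b::topological_space"
  assumes "f \<in> borel_measurable borel"
  shows "f \<in> borel_measurable (lebesgue_on S)"
  using assms by (intro measurable_restrict_space1 measurable_completion) simp

lemma AE_lebesgue_on_iff:
  assumes "open S"
  shows "(AE x in lebesgue_on S. P x) \<longleftrightarrow> (AE x in lborel. x \<in> S \<longrightarrow> P x)"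
  using assms by (subst AE_restrict_space_iff) (auto simp: AE_completion_iff)

text \<open>On each open cell the field is replaced by its polynomial, and off the cells by zero. The
  cells are disjoint and open, so this function is locally a polynomial at each of their points,
  and the points of \<open>S\<close> in no cell form a null set. Boundedness of \<open>S\<close> bounds the polynomials.\<close>

lemma piecewise_poly_regular_representative:
  fixes v :: "real^3 \<Rightarrow> 'b::euclidean_space"
  assumes S: "open S" "bounded S" and mesh: "is_mesh S \<K>" and v: "piecewise_poly \<K> v"
  shows "\<exists>b. regular_on S b \<and> ae_eq S v b"
proof -
  obtain p where p: "\<And>K. K \<in> \<K> \<Longrightarrow> polynomial_function (p K)" "\<And>K. K \<in> \<K> \<Longrightarrow> ae_eq K v (p K)"
    using v by (metis piecewise_poly_def)
  have fin: "finite \<K>" and disj: "disjoint \<K>" and op: "\<And>K. K \<in> \<K> \<Longrightarrow> open K"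
    and sub: "\<And>K. K \<in> \<K> \<Longrightarrow> K \<subseteq> S" and null: "negligible (S - \<Union>\<K>)"
    using mesh by (auto simp: is_mesh_def)
  define b where "b y = (\<Sum>K\<in>\<K>. indicator K y *\<^sub>R p K y)" for y
  have b_eq: "b y = p K y" if "K \<in> \<K>" "y \<in> K" for K y
  proof -
    \<comment> \<open>Disjointness of the cells leaves one nonzero summand.\<close>
    have "b y = (\<Sum>L\<in>\<K>. if L = K then p K y else 0)"
      unfolding b_def using that disj
      by (intro sum.cong) (auto simp: indicator_def pairwise_def disjnt_def)
    then show ?thesis
      using fin that by simp
  qed
  have cont: "continuous_on UNIV (p K)" if "K \<in> \<K>" for K
    using p(1)[OF that] by (rule continuous_on_polymonial_function)
  have meas: "b \<in> borel_measurable borel"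
    unfolding b_def using op
    by (intro borel_measurable_sum borel_measurable_scaleR borel_measurable_indicator
        borel_measurable_continuous_onI cont) auto
  have "\<exists>M. \<forall>y. norm (indicator K y *\<^sub>R p K y) \<le> M" if K: "K \<in> \<K>" for K
  proof -
    have "bounded (p K ` closure S)"
      using S(2) by (intro compact_imp_bounded compact_continuous_image
          continuous_on_subset[OF cont[OF K]]) auto
    then obtain M where "M > 0" "\<forall>y\<in>closure S. norm (p K y) \<le> M"
      by (auto simp: bounded_pos)
    then show ?thesis
      using sub[OF K] closure_subset[of S] by (intro exI[of _ M]) (auto simp: indicator_def)
  qed
  then obtain M where M: "\<And>K y. K \<in> \<K> \<Longrightarrow> norm (indicator K y *\<^sub>R p K y) \<le> M K"
    by metis
  have "norm (b y) \<le> (\<Sum>K\<in>\<K>. M K)" for y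
    unfolding b_def by (intro order_trans[OF norm_sum] sum_mono M)
  then have bound: "bounded (range b)"
    by (auto simp: bounded_iff)
  have cells: "AE x in lborel. x \<in> S \<longrightarrow> x \<in> \<Union>\<K>"
  proof -
    have "AE x in lebesgue. x \<notin> S - \<Union>\<K>"
      using null by (intro AE_not_in) (simp add: negligible_iff_null_sets)
    then show ?thesis
      by (simp add: AE_completion_iff)
  qed
  have isCont: "isCont b x" if "K \<in> \<K>" "x \<in> K" for K x
  proof -
    have "continuous_on K b"
      using cont[OF that(1)] b_eq[OF that(1)]
      by (metis continuous_on_cong continuous_on_subset subset_UNIV)
    then show ?thesis
      using op that by (simp add: continuous_on_eq_continuous_at)
  qed
  have "AE x in lborel. \<forall>K\<in>\<K>. x \<in> K \<longrightarrow> v x = p K x"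
    using p(2) op fin by (intro AE_finite_allI) (auto simp: ae_eq_def AE_lebesgue_on_iff)
  with cells have "ae_eq S v b"
    unfolding ae_eq_def AE_lebesgue_on_iff[OF S(1)] by eventually_elim (use b_eq in auto)
  moreover have "regular_on S b"
    unfolding regular_on_def
  proof (intro conjI allI impI meas bound)
    show "b x = 0" if "x \<notin> S" for x
      unfolding b_def using that sub by (intro sum.neutral) (auto simp: indicator_def)
    show "AE x in lborel. x \<in> S \<longrightarrow> isCont b x"
      using cells by eventually_elim (use isCont in auto)
  qed
  ultimately show ?thesis
    by blast
qed

lemma ip_cong_ae:
  assumes "ae_eq S v v'" and "ae_eq S w w'"
    and [measurable]: "v \<in> borel_measurable (lebesgue_on S)" "v' \<in> borel_measurable (lebesgue_on S)"
      "w \<in> borel_measurable (lebesgue_on S)" "w' \<in> borel_measurable (lebesgue_on S)"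
  shows "ip S v w = ip S v' w'"
  unfolding ip_def
  by (rule integral_cong_AE, measurable)
    (use assms(1,2) in \<open>auto simp: ae_eq_def elim: eventually_elim2\<close>)

lemma ip_lborel:
  assumes "open S" and [measurable]: "b \<in> borel_measurable borel" "w \<in> borel_measurable borel"
    and "\<And>x. x \<notin> S \<Longrightarrow> b x = 0"
  shows "ip S b w = (\<integral>x. b x \<bullet> w x \<partial>lborel)"
proof -
  have "ip S b w = (\<integral>x. indicator S x *\<^sub>R (b x \<bullet> w x) \<partial>lebesgue)"
    unfolding ip_def using assms(1) by (intro integral_restrict_space) auto
  also have "\<dots> = (\<integral>x. b x \<bullet> w x \<partial>lebesgue)"
    using assms(4) by (intro Bochner_Integration.integral_cong) (auto simp: indicator_def)
  also have "\<dots> = (\<integral>x. b x \<bullet> w x \<partial>lborel)"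
    by (rule integral_completion) measurable
  finally show ?thesis .
qed

lemma smooth_continuous:
  assumes "smooth \<phi>"
  shows "continuous_on UNIV \<phi>" and "continuous_on UNIV (pd i \<phi>)"
  using assms[unfolded smooth_def, rule_format, of 0] assms[unfolded smooth_def, rule_format, of 1]
  by auto

lemma measurable_ccurl:
  assumes "smooth \<phi>"
  shows "ccurl \<phi> \<in> borel_measurable borel"
proof -
  have [measurable]: "(\<lambda>x. pd i \<phi> x $ k) \<in> borel_measurable borel" for i k
    by (intro borel_measurable_continuous_onI continuous_intros smooth_continuous assms)
  have "(\<lambda>x. ccurl \<phi> x $ i) \<in> borel_measurable borel" for i
    unfolding ccurl_def using exhaust_3[of i] by auto
  then show ?thesis
    by (subst borel_measurable_euclidean_space) (auto simp: Basis_vec_def inner_axis)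
qed

text \<open>Vanishing of the tangential trace extends the defining identity of the weak curl from
  compactly supported test fields to all smooth ones.\<close>

lemma H0curl_weak_curl:
  assumes "v \<in> H0curl S"
  shows "v \<in> L2 S" and "wcurl S v \<in> L2 S"
    and "\<And>\<phi>. smooth \<phi> \<Longrightarrow> ip S v (ccurl \<phi>) = ip S (wcurl S v) \<phi>"
proof -
  show "v \<in> L2 S"
    using assms by (simp add: H0curl_def Hcurl_def)
  have "has_weak_curl S v (wcurl S v)"
    using assms someI_ex[of "has_weak_curl S v"] by (auto simp: wcurl_def H0curl_def Hcurl_def)
  then show "wcurl S v \<in> L2 S"
    by (simp add: has_weak_curl_def)
  show "ip S v (ccurl \<phi>) = ip S (wcurl S v) \<phi>" if "smooth \<phi>" for \<phi>
    using assms that by (simp add: H0curl_def tangential_trace_def)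
qed

lemma L2_measurable: "v \<in> L2 S \<Longrightarrow> v \<in> borel_measurable (lebesgue_on S)"
  by (simp add: L2_def)

lemma H0curl_symmetric:
  assumes S: "open S" "bounded S" and mesh: "is_mesh S \<K>"
    and v: "v \<in> H0curl S" "piecewise_poly \<K> v" "piecewise_poly \<K> (wcurl S v)"
    and w: "w \<in> H0curl S" "piecewise_poly \<K> w" "piecewise_poly \<K> (wcurl S w)"
  shows "ip S v (wcurl S w) = ip S (wcurl S v) w"
proof -
  note rep = piecewise_poly_regular_representative[OF S mesh]
  obtain b cb where b: "regular_on S b" "ae_eq S v b" "regular_on S cb" "ae_eq S (wcurl S v) cb"
    using rep[OF v(2)] rep[OF v(3)] by blast
  obtain d cd where d: "regular_on S d" "ae_eq S w d" "regular_on S cd" "ae_eq S (wcurl S w) cd"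
    using rep[OF w(2)] rep[OF w(3)] by blast
  note reg = b(1,3) d(1,3)
  note [measurable] = reg[THEN regular_onD(1)] reg[THEN regular_onD(1), THEN borel_measurable_lebesgue_on]
  note L2 = H0curl_weak_curl(1,2)[OF v(1)] H0curl_weak_curl(1,2)[OF w(1)]
  note [measurable] = L2[THEN L2_measurable]
  have weak: "(\<integral>x. g x \<bullet> ccurl \<phi> x \<partial>lborel) = (\<integral>x. cg x \<bullet> \<phi> x \<partial>lborel)"
    if f: "f \<in> H0curl S" "ae_eq S f g" "ae_eq S (wcurl S f) cg" and g: "regular_on S g" "regular_on S cg"
      and \<phi>: "smooth \<phi>" for f g cg \<phi>
  proof -
    note [measurable] = g[THEN regular_onD(1)] g[THEN regular_onD(1), THEN borel_measurable_lebesgue_on]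
      H0curl_weak_curl(1,2)[OF f(1), THEN L2_measurable]
    have \<phi>' [measurable]: "\<phi> \<in> borel_measurable borel" "ccurl \<phi> \<in> borel_measurable borel"
      using \<phi> by (auto intro: borel_measurable_continuous_onI smooth_continuous measurable_ccurl)
    note [measurable] = \<phi>'[THEN borel_measurable_lebesgue_on]
    have "(\<integral>x. g x \<bullet> ccurl \<phi> x \<partial>lborel) = ip S g (ccurl \<phi>)"
      using S(1) g(1) by (subst ip_lborel) (auto dest: regular_onD)
    also have "\<dots> = ip S f (ccurl \<phi>)"
      using f(2) by (intro ip_cong_ae; measurable?) (auto simp: ae_eq_def)
    also have "\<dots> = ip S (wcurl S f) \<phi>"
      by (rule H0curl_weak_curl(3)[OF f(1) \<phi>])
    also have "\<dots> = ip S cg \<phi>"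
      using f(3) by (intro ip_cong_ae; measurable?) (auto simp: ae_eq_def)
    also have "\<dots> = (\<integral>x. cg x \<bullet> \<phi> x \<partial>lborel)"
      using S(1) g(2) by (subst ip_lborel) (auto dest: regular_onD)
    finally show ?thesis .
  qed
  have "ip S v (wcurl S w) = ip S b cd"
    using b(2) d(4) by (intro ip_cong_ae; measurable?)
  also have "\<dots> = (\<integral>x. b x \<bullet> cd x \<partial>lborel)"
    using S(1) b(1) by (subst ip_lborel) (auto dest: regular_onD)
  also have "\<dots> = (\<integral>x. cb x \<bullet> d x \<partial>lborel)"
    using weak_curl_symmetric[OF S reg] weak[OF v(1) b(2,4) b(1,3)] weak[OF w(1) d(2,4) d(1,3)] by blast
  also have "\<dots> = ip S cb d"
    using S(1) b(3) by (subst ip_lborel) (auto dest: regular_onD)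
  also have "\<dots> = ip S (wcurl S v) w"
    using b(4) d(2) by (intro ip_cong_ae[symmetric]; measurable?)
  finally show ?thesis .
qed

section \<open>Discrete spaces and essentially bounded fields\<close>

lemma L2_lincomb:
  fixes v w :: "real^3 \<Rightarrow> 'b::euclidean_space"
  assumes "v \<in> L2 S" and "w \<in> L2 S"
  shows "(\<lambda>x. a *\<^sub>R v x + b *\<^sub>R w x) \<in> L2 S"
proof -
  note [measurable] = assms[THEN L2_measurable]
  have le: "(norm (a *\<^sub>R v x + b *\<^sub>R w x))\<^sup>2 \<le> 2 * a\<^sup>2 * (norm (v x))\<^sup>2 + 2 * b\<^sup>2 * (norm (w x))\<^sup>2" for x
  proof -
    have "(norm (a *\<^sub>R v x + b *\<^sub>R w x))\<^sup>2 \<le> (norm (a *\<^sub>R v x) + norm (b *\<^sub>R w x))\<^sup>2"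
      by (intro power_mono norm_triangle_ineq) simp
    also have "\<dots> \<le> 2 * (norm (a *\<^sub>R v x))\<^sup>2 + 2 * (norm (b *\<^sub>R w x))\<^sup>2"
      using sum_squares_bound[of "norm (a *\<^sub>R v x)" "norm (b *\<^sub>R w x)"] by (simp add: power2_sum)
    finally show ?thesis
      by (simp add: power_mult_distrib)
  qed
  have "integrable (lebesgue_on S) (\<lambda>x. 2 * a\<^sup>2 * (norm (v x))\<^sup>2 + 2 * b\<^sup>2 * (norm (w x))\<^sup>2)"
    using assms by (auto simp: L2_def)
  then have "integrable (lebesgue_on S) (\<lambda>x. (norm (a *\<^sub>R v x + b *\<^sub>R w x))\<^sup>2)"
    by (rule Bochner_Integration.integrable_bound, measurable) (simp add: le)
  then show ?thesis
    by (simp add: L2_def)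
qed

lemma fin_dim_subspace_lincomb:
  assumes V: "fin_dim_subspace S V" and "v \<in> V" and "w \<in> V"
  shows "(\<lambda>x. a *\<^sub>R v x + b *\<^sub>R w x) \<in> V"
proof -
  obtain \<B> where \<B>: "V = {v \<in> L2 S. \<exists>c. ae_eq S v (\<lambda>x. \<Sum>b\<in>\<B>. c b *\<^sub>R b x)}"
    using V by (auto simp: fin_dim_subspace_def)
  obtain c d where "v \<in> L2 S" "w \<in> L2 S" and c: "ae_eq S v (\<lambda>x. \<Sum>b\<in>\<B>. c b *\<^sub>R b x)"
    and d: "ae_eq S w (\<lambda>x. \<Sum>b\<in>\<B>. d b *\<^sub>R b x)"
    using assms(2,3) \<B> by auto
  have "ae_eq S (\<lambda>x. a *\<^sub>R v x + b *\<^sub>R w x) (\<lambda>x. \<Sum>k\<in>\<B>. (a * c k + b * d k) *\<^sub>R k x)"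
    using c d unfolding ae_eq_def
    by eventually_elim (simp add: scaleR_sum_right sum.distrib scaleR_add_left)
  then show ?thesis
    unfolding \<B> using L2_lincomb[OF \<open>v \<in> L2 S\<close> \<open>w \<in> L2 S\<close>]
    by (intro CollectI conjI exI[of _ "\<lambda>k. a * c k + b * d k"])
qed

lemma fin_dim_subspace_Dt_mid:
  assumes "fin_dim_subspace S V" and "a (Suc n) \<in> V" and "a n \<in> V"
  shows "Dt \<tau> a n \<in> V" and "mid a n \<in> V"
  using fin_dim_subspace_lincomb[OF assms, of "1 / \<tau>" "- (1 / \<tau>)"]
    fin_dim_subspace_lincomb[OF assms, of "1 / 2" "1 / 2"]
  by (simp_all add: Dt_def[abs_def] mid_def[abs_def] scaleR_add_right scaleR_diff_right)

text \<open>The inner product is additive only on integrable products, and Ohm's law contains the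
  product \<open>(u \<times> H) \<bullet> \<omega>\<close> of three fields, for which square integrability of the factors does not
  suffice. Essentially bounded fields are closed under cross products as well.\<close>

definition ess_bounded :: "(real^3) set \<Rightarrow> (real^3 \<Rightarrow> 'b::euclidean_space) \<Rightarrow> bool" where
  "ess_bounded S v \<longleftrightarrow> v \<in> borel_measurable (lebesgue_on S) \<and>
     (\<exists>M. AE x in lebesgue_on S. norm (v x) \<le> M)"

lemma ess_bounded_measurable: "ess_bounded S v \<Longrightarrow> v \<in> borel_measurable (lebesgue_on S)"
  by (simp add: ess_bounded_def)

lemma ess_bounded_scaleR:
  assumes "ess_bounded S v"
  shows "ess_bounded S (\<lambda>x. a *\<^sub>R v x)"
proof -
  note [measurable] = assms[THEN ess_bounded_measurable]
  obtain M where "AE x in lebesgue_on S. norm (v x) \<le> M"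
    using assms by (auto simp: ess_bounded_def)
  then have "AE x in lebesgue_on S. norm (a *\<^sub>R v x) \<le> \<bar>a\<bar> * M"
    by eventually_elim (simp add: mult_left_mono)
  then show ?thesis
    by (auto simp: ess_bounded_def)
qed

lemma ess_bounded_add:
  assumes "ess_bounded S v" and "ess_bounded S w"
  shows "ess_bounded S (\<lambda>x. v x + w x)"
proof -
  note [measurable] = assms[THEN ess_bounded_measurable]
  obtain M N where "AE x in lebesgue_on S. norm (v x) \<le> M" "AE x in lebesgue_on S. norm (w x) \<le> N"
    using assms by (auto simp: ess_bounded_def)
  then have "AE x in lebesgue_on S. norm (v x + w x) \<le> M + N"
    by eventually_elim (rule norm_triangle_mono)
  then show ?thesis
    by (auto simp: ess_bounded_def)
qed

lemma ess_bounded_diff: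
  assumes "ess_bounded S v" and "ess_bounded S w"
  shows "ess_bounded S (\<lambda>x. v x - w x)"
  using ess_bounded_add[OF assms(1) ess_bounded_scaleR[OF assms(2), of "-1"]] by simp

lemma ess_bounded_cross3:
  assumes "ess_bounded S v" and "ess_bounded S w"
  shows "ess_bounded S (\<lambda>x. cross3 (v x) (w x))"
proof -
  note [measurable] = assms[THEN ess_bounded_measurable]
  obtain M N where "AE x in lebesgue_on S. norm (v x) \<le> M" "AE x in lebesgue_on S. norm (w x) \<le> N"
    using assms by (auto simp: ess_bounded_def)
  then have "AE x in lebesgue_on S. norm (cross3 (v x) (w x)) \<le> M * N"
    by eventually_elim (auto intro: order_trans[OF norm_cross3_le] mult_mono order_trans[OF norm_ge_zero])
  then show ?thesis
    by (auto simp: ess_bounded_def)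
qed

lemmas ess_bounded_intros = ess_bounded_add ess_bounded_diff ess_bounded_scaleR ess_bounded_cross3

lemma integrable_inner_ess_bounded:
  assumes S: "open S" "bounded S" and v: "ess_bounded S v" and w: "ess_bounded S w"
  shows "integrable (lebesgue_on S) (\<lambda>x. v x \<bullet> w x)"
proof -
  note [measurable] = v[THEN ess_bounded_measurable] w[THEN ess_bounded_measurable]
  obtain M N where "AE x in lebesgue_on S. norm (v x) \<le> M" "AE x in lebesgue_on S. norm (w x) \<le> N"
    using v w by (auto simp: ess_bounded_def)
  then have "AE x in lebesgue_on S. norm (v x \<bullet> w x) \<le> M * N"
    by eventually_elim
      (auto intro!: order_trans[OF Cauchy_Schwarz_ineq2] mult_mono intro: order_trans[OF norm_ge_zero])
  moreover have "finite_measure (lebesgue_on S)"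
    using S by (intro finite_measure_lebesgue_on lmeasurable_open)
  ultimately show ?thesis
    by (intro finite_measure.integrable_const_bound[where B="M * N"]) auto
qed

lemma ip_add_left:
  assumes "open S" "bounded S" "ess_bounded S v" "ess_bounded S w" "ess_bounded S z"
  shows "ip S (\<lambda>x. v x + w x) z = ip S v z + ip S w z"
  unfolding ip_def inner_add_left
  using assms by (intro Bochner_Integration.integral_add integrable_inner_ess_bounded)

lemma ip_diff_left:
  assumes "open S" "bounded S" "ess_bounded S v" "ess_bounded S w" "ess_bounded S z"
  shows "ip S (\<lambda>x. v x - w x) z = ip S v z - ip S w z"
  unfolding ip_def inner_diff_left
  using assms by (intro Bochner_Integration.integral_diff integrable_inner_ess_bounded)

lemma ip_scaleR_left: "ip S (\<lambda>x. a *\<^sub>R v x) w = a * ip S v w"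
  by (simp add: ip_def)

lemma ip_commute: "ip S v w = ip S w v"
  by (simp add: ip_def inner_commute)

lemma ip_self_eq_0D:
  assumes "open S" "bounded S" "ess_bounded S v" and "ip S v v = 0"
  shows "ae_eq S v (\<lambda>_. 0)"
  using assms(4) integral_nonneg_eq_0_iff_AE[OF integrable_inner_ess_bounded[OF assms(1-3) assms(3)]]
  by (simp add: ip_def ae_eq_def)

lemma L2_piecewise_poly_ess_bounded:
  assumes S: "open S" "bounded S" and mesh: "is_mesh S \<K>" and v: "piecewise_poly \<K> v" "v \<in> L2 S"
  shows "ess_bounded S v"
proof -
  obtain b where b: "regular_on S b" "ae_eq S v b"
    using piecewise_poly_regular_representative[OF S mesh v(1)] by blast
  obtain M where "\<And>x. norm (b x) \<le> M"
    using regular_onD(4)[OF b(1)] by blast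
  with b(2) have "AE x in lebesgue_on S. norm (v x) \<le> M"
    by (auto simp: ae_eq_def elim: eventually_mono)
  with v(2) show ?thesis
    by (auto simp: ess_bounded_def L2_def)
qed

section \<open>The discrete de Rham complex\<close>

lemma discrete_de_rham_maps:
  assumes "discrete_de_rham S Vg Vc Vd V0"
  shows "fin_dim_subspace S Vc" and "fin_dim_subspace S Vd"
    and "\<And>q. q \<in> Vg \<Longrightarrow> wgrad S q \<in> Vc"
    and "\<And>q. q \<in> Vg \<Longrightarrow> ae_eq S (wcurl S (wgrad S q)) (\<lambda>_. 0)"
    and "\<And>v. v \<in> Vc \<Longrightarrow> wcurl S v \<in> Vd"
    and "\<And>v. v \<in> Vd \<Longrightarrow> ae_eq S (wdiv S v) (\<lambda>_. 0) \<Longrightarrow> \<exists>w\<in>Vc. ae_eq S v (wcurl S w)"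
proof -
  have refl: "ae_eq S w w" for w :: vector_field
    by (simp add: ae_eq_def)
  show "fin_dim_subspace S Vc" "fin_dim_subspace S Vd"
    using assms by (auto simp: discrete_de_rham_def fe_subspace_def)
  have g: "{w. \<exists>q\<in>Vg. ae_eq S w (wgrad S q)} = {v \<in> Vc. ae_eq S (wcurl S v) (\<lambda>_. 0)}"
    and c: "{w. \<exists>v\<in>Vc. ae_eq S w (wcurl S v)} = {v \<in> Vd. ae_eq S (wdiv S v) (\<lambda>_. 0)}"
    using assms by (simp_all add: discrete_de_rham_def)
  show "wgrad S q \<in> Vc" "ae_eq S (wcurl S (wgrad S q)) (\<lambda>_. 0)" if "q \<in> Vg" for q
    using g refl that by blast+
  show "wcurl S v \<in> Vd" if "v \<in> Vc" for v
    using c refl that by blast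
  show "\<exists>w\<in>Vc. ae_eq S v (wcurl S w)" if "v \<in> Vd" "ae_eq S (wdiv S v) (\<lambda>_. 0)" for v
    using c that by blast
qed

lemma discrete_ess_bounded:
  assumes S: "open S" "bounded S" and V: "discrete_de_rham S Vg Vc Vd V0" and "v \<in> Vc \<union> Vd"
  shows "ess_bounded S v"
proof -
  obtain \<K> where \<K>: "is_mesh S \<K>" "fe_subspace S \<K> (H0curl S) Vc" "fe_subspace S \<K> (H0div S) Vd"
    using V by (auto simp: discrete_de_rham_def)
  then have "piecewise_poly \<K> v" "v \<in> L2 S"
    using \<open>v \<in> Vc \<union> Vd\<close> by (auto simp: fe_subspace_def H0curl_def Hcurl_def H0div_def Hdiv_def)
  then show ?thesis
    by (rule L2_piecewise_poly_ess_bounded[OF S \<K>(1)])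
qed

text \<open>The complex property puts the curl of a discrete field in the discrete div space, so it is
  again piecewise polynomial, on the same mesh as the field itself.\<close>

lemma discrete_curl_symmetric:
  assumes S: "open S" "bounded S" and V: "discrete_de_rham S Vg Vc Vd V0" and "v \<in> Vc" "w \<in> Vc"
  shows "ip S v (wcurl S w) = ip S (wcurl S v) w"
proof -
  obtain \<K> where \<K>: "is_mesh S \<K>" "fe_subspace S \<K> (H0curl S) Vc" "fe_subspace S \<K> (H0div S) Vd"
    using V by (auto simp: discrete_de_rham_def)
  show ?thesis
    by (rule H0curl_symmetric[OF S \<K>(1)])
      (use \<K> assms(4,5) discrete_de_rham_maps(5)[OF V] in \<open>auto simp: fe_subspace_def\<close>)
qed

text \<open>Integration by parts moves the curl onto the gradient, where it vanishes. By exactness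
  the curls are the solenoidal discrete fields, so this is their orthogonality to gradients.\<close>

lemma discrete_curl_orthogonal_grad:
  assumes S: "open S" "bounded S" and V: "discrete_de_rham S Vg Vc Vd V0" and v: "v \<in> Vc" and q: "q \<in> Vg"
  shows "ip S (wcurl S v) (wgrad S q) = 0"
proof -
  note dom = discrete_de_rham_maps[OF V]
  have "ip S (wcurl S v) (wgrad S q) = ip S v (wcurl S (wgrad S q))"
    using discrete_curl_symmetric[OF S V v dom(3)[OF q]] by simp
  also have "\<dots> = ip S v (\<lambda>_. 0)"
    using dom(5)[OF v] dom(3)[OF q] dom(5)[OF dom(3)[OF q]] discrete_ess_bounded[OF S V] v dom(4)[OF q]
    by (intro ip_cong_ae) (auto simp: ae_eq_def intro: ess_bounded_measurable)
  finally show ?thesis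
    by (simp add: ip_def)
qed

section \<open>The cross helicity identity\<close>

theorem theorem6:
  fixes \<Omega> :: "(real^3) set"
    and Vg V0 :: "scalar_field set" and Vc Vd :: "vector_field set"
    and \<tau> c :: real and R\<^sub>e R\<^sub>m :: ereal
    and f :: "real \<Rightarrow> vector_field"
    and u B \<omega> j E H :: "nat \<Rightarrow> vector_field" and P :: "nat \<Rightarrow> scalar_field"
  assumes "lipschitz_domain \<Omega>" and "contractible \<Omega>"
    and "discrete_de_rham \<Omega> Vg Vc Vd V0"
    and "\<tau> > 0" and "c > 0" and "R\<^sub>e > 0" and "R\<^sub>m > 0"
    and "\<And>t. t \<ge> 0 \<Longrightarrow> f t \<in> L2 \<Omega>"
    and "mhd_solution \<Omega> Vg Vc Vd \<tau> c R\<^sub>e R\<^sub>m f u B \<omega> j E H P"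
    and "ae_eq \<Omega> (wdiv \<Omega> (B 0)) (\<lambda>_. 0)"
  shows "\<forall>n. Dt_int \<Omega> \<tau> u B n =
           - rinv R\<^sub>e * ip \<Omega> (wcurl \<Omega> (mid u n)) (wcurl \<Omega> (H n))
           - rinv R\<^sub>m * ip \<Omega> (wcurl \<Omega> (mid u n)) (j n)
           + ip \<Omega> (fmid \<tau> f n) (H n)"
proof
  fix n
  have S: "open \<Omega>" "bounded \<Omega>"
    using assms(1) by (auto simp: lipschitz_domain_def)
  note V = assms(3) and sol = assms(9)[unfolded mhd_solution_def]
  note dom = discrete_de_rham_maps[OF V]
  have mem: "u n \<in> Vc" "B n \<in> Vd" "\<omega> n \<in> Vc" "j n \<in> Vc" "E n \<in> Vc" "H n \<in> Vc" "P n \<in> Vg" for n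
    using sol by auto
  have bdd: "ess_bounded \<Omega> v" if "v \<in> Vc \<or> v \<in> Vd" for v
    using discrete_ess_bounded[OF S V] that by blast
  have Dt_u: "Dt \<tau> u n \<in> Vc" and mid_u: "mid u n \<in> Vc" and Dt_B: "Dt \<tau> B n \<in> Vd" and mid_B: "mid B n \<in> Vd" for n
    using fin_dim_subspace_Dt_mid[OF dom(1)] fin_dim_subspace_Dt_mid[OF dom(2)] mem by auto
  have momentum: "ip \<Omega> (Dt \<tau> u n) v - ip \<Omega> (\<lambda>x. cross3 (mid u n x) (\<omega> n x)) v
        + rinv R\<^sub>e * ip \<Omega> (wcurl \<Omega> (mid u n)) (wcurl \<Omega> v) + ip \<Omega> (wgrad \<Omega> (P n)) v
        - c * ip \<Omega> (\<lambda>x. cross3 (j n x) (H n x)) v = ip \<Omega> (fmid \<tau> f n) v"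
    and ohm: "ip \<Omega> (\<lambda>x. rinv R\<^sub>m *\<^sub>R j n x - (E n x + cross3 (mid u n x) (H n x))) v = 0"
    and vorticity: "ip \<Omega> (\<omega> n) v = ip \<Omega> (wcurl \<Omega> (mid u n)) v"
    and projection: "ip \<Omega> (mid B n) v = ip \<Omega> (H n) v"
    if "v \<in> Vc" for v n
    using sol that by (auto simp: algebra_simps)
  \<comment> \<open>The scheme states Faraday's law for discrete div test fields only. Testing it with its own
    residual shows that the residual vanishes almost everywhere, which admits discrete curl test fields.\<close>
  have faraday: "ip \<Omega> (Dt \<tau> B n) w = - ip \<Omega> (wcurl \<Omega> (E n)) w" if w: "w \<in> Vc \<or> w \<in> Vd" for w n
  proof -
    define X where "X x = Dt \<tau> B n x + wcurl \<Omega> (E n) x" for x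
    have X: "X \<in> Vd"
      using fin_dim_subspace_lincomb[OF dom(2) Dt_B[of n] dom(5)[OF mem(5)[of n]], of 1 1]
      by (simp add: X_def[abs_def])
    have split: "ip \<Omega> X v = ip \<Omega> (Dt \<tau> B n) v + ip \<Omega> (wcurl \<Omega> (E n)) v" if "v \<in> Vc \<or> v \<in> Vd" for v
      unfolding X_def using that by (intro ip_add_left S bdd) (auto simp: Dt_B dom(5) mem)
    have "ip \<Omega> X X = 0"
      using split[of X] sol X by auto
    then have "ae_eq \<Omega> X (\<lambda>_. 0)"
      using X by (intro ip_self_eq_0D S bdd) auto
    then have "ip \<Omega> X w = ip \<Omega> (\<lambda>_. 0) w"
      using X w bdd by (intro ip_cong_ae) (auto simp: ae_eq_def intro: ess_bounded_measurable)
    with split[OF w] show ?thesis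
      by (simp add: ip_def)
  qed
  \<comment> \<open>The divergence constraint is propagated in the form in which the pressure term uses it.\<close>
  have B_orth: "ip \<Omega> (B m) (wgrad \<Omega> q) = 0" if q: "q \<in> Vg" for m q
  proof (induction m)
    case 0
    obtain A where A: "A \<in> Vc" "ae_eq \<Omega> (B 0) (wcurl \<Omega> A)"
      using dom(6)[OF mem(2) assms(10)] by blast
    have "ip \<Omega> (B 0) (wgrad \<Omega> q) = ip \<Omega> (wcurl \<Omega> A) (wgrad \<Omega> q)"
      using A q bdd mem dom by (intro ip_cong_ae) (auto simp: ae_eq_def intro: ess_bounded_measurable)
    also have "\<dots> = 0"
      by (rule discrete_curl_orthogonal_grad[OF S V A(1) q])
    finally show ?case .
  next
    case (Suc m)
    have "B (Suc m) = (\<lambda>x. B m x + \<tau> *\<^sub>R Dt \<tau> B m x)"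
      using assms(4) by (simp add: Dt_def)
    then have "ip \<Omega> (B (Suc m)) (wgrad \<Omega> q) = ip \<Omega> (B m) (wgrad \<Omega> q) + \<tau> * ip \<Omega> (Dt \<tau> B m) (wgrad \<Omega> q)"
      using ip_add_left[OF S, of "B m" "\<lambda>x. \<tau> *\<^sub>R Dt \<tau> B m x" "wgrad \<Omega> q"] q
      by (simp add: bdd mem Dt_B dom ess_bounded_scaleR ip_scaleR_left)
    also have "\<dots> = 0"
      using Suc faraday[of "wgrad \<Omega> q" m] discrete_curl_orthogonal_grad[OF S V mem(5) q] dom(3)[OF q] by simp
    finally show ?case .
  qed
  have grad_P: "ip \<Omega> (wgrad \<Omega> (P n)) (H n) = 0"
  proof -
    have "ip \<Omega> (wgrad \<Omega> (P n)) (H n) = ip \<Omega> (mid B n) (wgrad \<Omega> (P n))"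
      using projection[OF dom(3)[OF mem(7)]] by (simp add: ip_commute)
    also have "\<dots> = (1 / 2) * ip \<Omega> (\<lambda>x. B (Suc n) x + B n x) (wgrad \<Omega> (P n))"
      unfolding mid_def by (rule ip_scaleR_left)
    also have "\<dots> = 0"
      using ip_add_left[OF S, of "B (Suc n)" "B n" "wgrad \<Omega> (P n)"]
      by (simp add: bdd mem dom B_orth)
    finally show ?thesis .
  qed
  have lorentz: "ip \<Omega> (\<lambda>x. cross3 (j n x) (H n x)) (H n) = 0"
    by (simp add: ip_def dot_cross_self)
  have velocity_part: "ip \<Omega> (Dt \<tau> u n) (mid B n) =
      ip \<Omega> (\<lambda>x. cross3 (mid u n x) (\<omega> n x)) (H n)
      - rinv R\<^sub>e * ip \<Omega> (wcurl \<Omega> (mid u n)) (wcurl \<Omega> (H n)) + ip \<Omega> (fmid \<tau> f n) (H n)"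
    using projection[OF Dt_u, of n n] momentum[OF mem(6), of n n] grad_P lorentz
    by (simp add: ip_commute[of _ "Dt \<tau> u n"])
  have magnetic_part: "ip \<Omega> (mid u n) (Dt \<tau> B n) =
      - rinv R\<^sub>m * ip \<Omega> (wcurl \<Omega> (mid u n)) (j n) + ip \<Omega> (\<lambda>x. cross3 (mid u n x) (H n x)) (\<omega> n)"
  proof -
    have "ip \<Omega> (mid u n) (Dt \<tau> B n) = - ip \<Omega> (wcurl \<Omega> (E n)) (mid u n)"
      using faraday[of "mid u n" n] mid_u by (simp add: ip_commute)
    also have "\<dots> = - ip \<Omega> (E n) (wcurl \<Omega> (mid u n))"
      using discrete_curl_symmetric[OF S V mem(5) mid_u] by simp
    also have "\<dots> = - ip \<Omega> (E n) (\<omega> n)"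
      using vorticity[OF mem(5), of n n] by (simp add: ip_commute)
    also have "\<dots> = - rinv R\<^sub>m * ip \<Omega> (j n) (\<omega> n) + ip \<Omega> (\<lambda>x. cross3 (mid u n x) (H n x)) (\<omega> n)"
    proof -
      have "0 = ip \<Omega> (\<lambda>x. rinv R\<^sub>m *\<^sub>R j n x) (\<omega> n) - ip \<Omega> (\<lambda>x. E n x + cross3 (mid u n x) (H n x)) (\<omega> n)"
        by (subst ip_diff_left[OF S, symmetric]) (auto simp: ohm mem mid_u bdd intro!: ess_bounded_intros)
      also have "ip \<Omega> (\<lambda>x. E n x + cross3 (mid u n x) (H n x)) (\<omega> n) =
          ip \<Omega> (E n) (\<omega> n) + ip \<Omega> (\<lambda>x. cross3 (mid u n x) (H n x)) (\<omega> n)"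
        by (rule ip_add_left[OF S]) (auto simp: mem mid_u bdd intro!: ess_bounded_intros)
      finally show ?thesis
        by (simp add: ip_scaleR_left)
    qed
    also have "ip \<Omega> (j n) (\<omega> n) = ip \<Omega> (wcurl \<Omega> (mid u n)) (j n)"
      using vorticity[OF mem(4), of n n] by (simp add: ip_commute)
    finally show ?thesis .
  qed
  have triple: "ip \<Omega> (\<lambda>x. cross3 (mid u n x) (H n x)) (\<omega> n) =
      - ip \<Omega> (\<lambda>x. cross3 (mid u n x) (\<omega> n x)) (H n)"
    by (simp add: ip_def cross3_simps flip: integral_minus)
  have "Dt_int \<Omega> \<tau> u B n = ip \<Omega> (Dt \<tau> u n) (mid B n) + ip \<Omega> (mid u n) (Dt \<tau> B n)"
  proof -
    have int: "integrable (lebesgue_on \<Omega>) (\<lambda>x. v x \<bullet> w x)" if "v \<in> Vc" "w \<in> Vd" for v w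
      using that by (intro integrable_inner_ess_bounded S bdd) auto
    have "Dt_int \<Omega> \<tau> u B n = (LINT x|lebesgue_on \<Omega>. (1 / \<tau>) * (u (Suc n) x \<bullet> B (Suc n) x - u n x \<bullet> B n x))"
      unfolding Dt_int_def by (simp add: int mem)
    also have "\<dots> = (LINT x|lebesgue_on \<Omega>. Dt \<tau> u n x \<bullet> mid B n x + mid u n x \<bullet> Dt \<tau> B n x)"
      by (intro Bochner_Integration.integral_cong)
        (auto simp: Dt_def mid_def inner_simps algebra_simps)
    also have "\<dots> = ip \<Omega> (Dt \<tau> u n) (mid B n) + ip \<Omega> (mid u n) (Dt \<tau> B n)"
      unfolding ip_def by (intro Bochner_Integration.integral_add int Dt_u mid_u Dt_B mid_B)
    finally show ?thesis .
  qed
  with velocity_part magnetic_part triple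
  show "Dt_int \<Omega> \<tau> u B n =
           - rinv R\<^sub>e * ip \<Omega> (wcurl \<Omega> (mid u n)) (wcurl \<Omega> (H n))
           - rinv R\<^sub>m * ip \<Omega> (wcurl \<Omega> (mid u n)) (j n)
           + ip \<Omega> (fmid \<tau> f n) (H n)"
    by simp
qed

end
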